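(* Let $k\ge 2$, $n\ge 1$, and let $F=S\circ J\circ T^{-1}:\mathbf{P}^k\dashrightarrow\mathbf{P}^k$ be a basic cremona map that properly fixes $C$ and satisfies (a) $S(\mathbf{e}_j)=T(\mathbf{e}_{j+1})$ for $j=0,1,\dots,k-1$; (b) $F^{n-1}(S(\mathbf{e}_k))=T(\mathbf{e}_0)$; (c) $F^{j}(S(\mathbf{e}_k))\notin I(F)$ for $0\le j<n-1$. Suppose that $F|_C$ is given by $F(\gamma(t))=\gamma(\delta(t-1)+1)$, where $\delta\in\mathbf{C}^*$ is not a root of unity, and define $t_j^+\in\mathbf{C}$ by $\gamma(t_j^+)=T(\mathbf{e}_j)$, $0\le j\le k$. Then $\delta$ is a root of the polynomial $$(\delta^{n+k}-1)(\delta^2-1)-\delta(\delta^{k+1}-1)(\delta^{n-1}-1),$$ and for every $0\le j\le k$, $$t_j^+=\delta^j\,\frac{k+1}{k-1}\cdot\frac{\delta^2-1}{\delta(\delta^{k+1}-1)}-\frac{2}{k-1}.$$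
   Context: $\mathbf{P}^k$ is complex projective space with homogeneous coordinates $[x_0:\dots:x_k]$, and $\mathbf{e}_j\in\mathbf{P}^k$ is the point whose only nonzero coordinate is the $j$-th. $C\subset\mathbf{P}^k$ is the curve of degree $k+1$ parametrized by $\gamma:\mathbf{C}\cup\{\infty\}\to\mathbf{P}^k$, $\gamma(t)=[1:t:\dots:t^{k-1}:t^{k+1}]$, $\gamma(\infty)=[0:\dots:0:1]$; its only singular point is the cusp $\gamma(\infty)$ and $C_{reg}=\gamma(\mathbf{C})$. $J:\mathbf{P}^k\dashrightarrow\mathbf{P}^k$ is the birational involution $J[x_0:\dots:x_k]=[1/x_0:\dots:1/x_k]$. A basic cremona map is a birational map of the form $F=S\circ J\circ T^{-1}$ with $S,T\in\mathrm{Aut}(\mathbf{P}^k)$. $I(F)$ is the indeterminacy set of $F$. $F$ is centered on $C$ if $T(\mathbf{e}_j)\in C_{reg}$ for all $0\le j\le k$, and $F$ properly fixes $C$ if it is centered on $C$ and $F(C)=C$ (proper transform); $F|_C$ then denotes the induced automorphism of $C$. *)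

theory Defs
  imports Complex_Main "Jordan_Normal_Form.Matrix"
begin

text \<open>
  Points of \<open>P\<^sup>k\<close> are lines in \<open>C\<^sup>k\<^sup>+\<^sup>1\<close> through the origin with the origin removed, so that
  \<open>[x]\<close> is the set of all homogeneous coordinate vectors of the point.
\<close>

type_synonym ppoint = "complex vec set"

definition proj :: "complex vec \<Rightarrow> ppoint" where
  "proj x = {c \<cdot>\<^sub>v x | c. c \<noteq> 0}"

definition PS :: "nat \<Rightarrow> ppoint set" where
  "PS k = {proj x | x. x \<in> carrier_vec (k + 1) \<and> x \<noteq> 0\<^sub>v (k + 1)}"

definition pt_e :: "nat \<Rightarrow> nat \<Rightarrow> ppoint" where
  "pt_e k j = proj (unit_vec (k + 1) j)"

definition Aut_PS :: "nat \<Rightarrow> (ppoint \<Rightarrow> ppoint) set" where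
  "Aut_PS k = {(\<lambda>p. (\<lambda>x. A *\<^sub>v x) ` p) | A. A \<in> carrier_mat (k + 1) (k + 1) \<and> invertible_mat A}"


text \<open>
  Over the infinite field of complex numbers polynomials may be identified with polynomial functions.
\<close>

inductive_set poly_funs :: "nat \<Rightarrow> (complex vec \<Rightarrow> complex) set" for k where
  const: "(\<lambda>x. c) \<in> poly_funs k"
| coord: "i \<le> k \<Longrightarrow> (\<lambda>x. x $ i) \<in> poly_funs k"
| add: "f \<in> poly_funs k \<Longrightarrow> g \<in> poly_funs k \<Longrightarrow> (\<lambda>x. f x + g x) \<in> poly_funs k"
| mult: "f \<in> poly_funs k \<Longrightarrow> g \<in> poly_funs k \<Longrightarrow> (\<lambda>x. f x * g x) \<in> poly_funs k"

definition hom_poly :: "nat \<Rightarrow> nat \<Rightarrow> (complex vec \<Rightarrow> complex) \<Rightarrow> bool" where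
  "hom_poly k d f \<longleftrightarrow> f \<in> poly_funs k \<and>
     (\<forall>x\<in>carrier_vec (k + 1). \<forall>c. f (c \<cdot>\<^sub>v x) = c ^ d * f x)"

definition hom_map :: "nat \<Rightarrow> (complex vec \<Rightarrow> complex vec) \<Rightarrow> bool" where
  "hom_map k G \<longleftrightarrow> (\<forall>x\<in>carrier_vec (k + 1). G x \<in> carrier_vec (k + 1)) \<and>
     (\<exists>d. \<forall>i\<le>k. hom_poly k d (\<lambda>x. G x $ i))"

definition zariski_closure :: "nat \<Rightarrow> ppoint set \<Rightarrow> ppoint set" where
  "zariski_closure k X = {p \<in> PS k. \<forall>d f. hom_poly k d f \<and> (\<forall>q\<in>X. \<forall>x\<in>q. f x = 0) \<longrightarrow> (\<forall>x\<in>p. f x = 0)}"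


text \<open>
  A rational map is a partial function on points, defined exactly off its indeterminacy set.
  The map \<open>ratmap k G\<close> is the one given by the tuple \<open>G\<close> of homogeneous polynomials of equal degree:
  it is defined at \<open>p\<close> if some tuple \<open>H\<close> proportional to \<open>G\<close> does not vanish at \<open>p\<close>, with
  value \<open>[H(p)]\<close>.  As points do not contain the zero vector, \<open>H ` p \<subseteq> q\<close> for \<open>q \<in> PS k\<close> says that
  \<open>H\<close> does not vanish at \<open>p\<close> and \<open>q = [H(p)]\<close>.
\<close>

definition same_ratmap :: "nat \<Rightarrow> (complex vec \<Rightarrow> complex vec) \<Rightarrow> (complex vec \<Rightarrow> complex vec) \<Rightarrow> bool" where
  "same_ratmap k G H \<longleftrightarrow>
     (\<forall>x\<in>carrier_vec (k + 1). \<forall>i\<le>k. \<forall>j\<le>k. G x $ i * H x $ j = G x $ j * H x $ i)"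

definition ratmap_val :: "nat \<Rightarrow> (complex vec \<Rightarrow> complex vec) \<Rightarrow> ppoint \<Rightarrow> ppoint \<Rightarrow> bool" where
  "ratmap_val k G p q \<longleftrightarrow> p \<in> PS k \<and> q \<in> PS k \<and>
     (\<exists>H. hom_map k H \<and> same_ratmap k G H \<and> H ` p \<subseteq> q)"

definition ratmap :: "nat \<Rightarrow> (complex vec \<Rightarrow> complex vec) \<Rightarrow> ppoint \<Rightarrow> ppoint option" where
  "ratmap k G p = (if \<exists>q. ratmap_val k G p q then Some (THE q. ratmap_val k G p q) else None)"

definition indet :: "nat \<Rightarrow> (ppoint \<Rightarrow> ppoint option) \<Rightarrow> ppoint set" where
  "indet k F = {p \<in> PS k. F p = None}"

text \<open>
  The involution \<open>J\<close>: multiplying \<open>[1/x\<^sub>0 : \<dots> : 1/x\<^sub>k]\<close> by \<open>x\<^sub>0 \<cdots> x\<^sub>k\<close> clears the denominators.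
\<close>

definition J_poly :: "nat \<Rightarrow> complex vec \<Rightarrow> complex vec" where
  "J_poly k x = vec (k + 1) (\<lambda>i. \<Prod>j\<in>{..k} - {i}. x $ j)"

definition J_map :: "nat \<Rightarrow> ppoint \<Rightarrow> ppoint option" where
  "J_map k = ratmap k (J_poly k)"

lemma proj_vec_eqI:
  assumes "y \<in> carrier_vec (k+1)" "z \<in> carrier_vec (k+1)" "y \<noteq> 0\<^sub>v (k+1)" "z \<noteq> 0\<^sub>v (k+1)"
    and "\<And>i j. i \<le> k \<Longrightarrow> j \<le> k \<Longrightarrow> y $ i * z $ j = y $ j * (z $ i :: complex)"
  shows "y \<in> proj z"
proof -
  obtain i where i: "i \<le> k" "z $ i \<noteq> 0"
    using assms(2,4) by (auto simp: vec_eq_iff less_Suc_eq_le)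
  have e: "y = (y $ i / z $ i) \<cdot>\<^sub>v z"
  proof (rule eq_vecI)
    fix j assume "j < dim_vec ((y $ i / z $ i) \<cdot>\<^sub>v z)"
    then have "j \<le> k" using assms by auto
    then show "y $ j = ((y $ i / z $ i) \<cdot>\<^sub>v z) $ j"
      using assms(1,2) i assms(5)[of i j] by (auto simp: field_simps)
  qed (use assms in auto)
  have "y $ i / z $ i \<noteq> 0"
  proof
    assume "y $ i / z $ i = 0"
    then have "y = 0 \<cdot>\<^sub>v z" using e by metis
    then show False using assms by (auto simp: vec_eq_iff)
  qed
  then show ?thesis using e unfolding proj_def by blast
qed

lemma proj_smult: "c \<noteq> 0 \<Longrightarrow> proj (c \<cdot>\<^sub>v x) = proj x"
  unfolding proj_def
  apply (auto simp: smult_smult_assoc)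
  subgoal for d by (rule exI[of _ "d / c"]) auto
  done

lemma prod_pf: "finite I \<Longrightarrow> I \<subseteq> {..k} \<Longrightarrow> (\<lambda>x. \<Prod>j\<in>I. x $ j) \<in> poly_funs k"
  by (induction I rule: finite_induct) (auto intro: poly_funs.intros)

lemma J_hom: "hom_map k (J_poly k)"
  unfolding hom_map_def
proof (intro conjI exI allI impI)
  fix i assume i: "i \<le> k"
  have e: "(\<lambda>x. J_poly k x $ i) = (\<lambda>x. \<Prod>j\<in>{..k} - {i}. x $ j)" using i by (auto simp: J_poly_def)
  show "hom_poly k k (\<lambda>x. J_poly k x $ i)"
    unfolding hom_poly_def e using i by (auto intro!: prod_pf simp: prod.distrib)
qed (auto simp: J_poly_def)

lemma J_map_at:
  assumes x: "x \<in> carrier_vec (k+1)" and nz: "J_poly k x \<noteq> 0\<^sub>v (k+1)" "x \<noteq> 0\<^sub>v (k+1)"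
  shows "J_map k (proj x) = Some (proj (J_poly k x))"
proof -
  have c: "J_poly k x \<in> carrier_vec (k+1)" by (auto simp: J_poly_def)
  have h: "J_poly k (c \<cdot>\<^sub>v x) = c^k \<cdot>\<^sub>v J_poly k x" for c
    by (rule eq_vecI) (use x in \<open>auto simp: J_poly_def prod.distrib\<close>)
  have v: "ratmap_val k (J_poly k) (proj x) (proj (J_poly k x))"
    unfolding ratmap_val_def
    using x nz c h J_hom[of k] unfolding same_ratmap_def PS_def
    by (intro conjI exI[of _ "J_poly k"]) (auto simp: proj_def)
  moreover have "q = proj (J_poly k x)" if q: "ratmap_val k (J_poly k) (proj x) q" for q
  proof -
    obtain H where H: "hom_map k H" "same_ratmap k (J_poly k) H" "H ` proj x \<subseteq> q" "q \<in> PS k"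
      using q unfolding ratmap_val_def by blast
    have xx: "x \<in> proj x" unfolding proj_def by (auto intro!: exI[of _ 1])
    then have Hq: "H x \<in> q" using H by auto
    obtain z where z: "q = proj z" "z \<in> carrier_vec (k+1)" "z \<noteq> 0\<^sub>v (k+1)" using H(4) unfolding PS_def by auto
    obtain d where d: "d \<noteq> 0" "H x = d \<cdot>\<^sub>v z" using Hq z unfolding proj_def by auto
    have Hn: "H x \<in> carrier_vec (k+1)" "H x \<noteq> 0\<^sub>v (k+1)"
      using z(2,3) d(1) by (simp_all add: d(2) vec_eq_iff)
    have "H x \<in> proj (J_poly k x)"
      by (rule proj_vec_eqI[OF Hn(1) c Hn(2) nz(1)])
         (use H(2) x in \<open>auto simp: same_ratmap_def mult.commute\<close>)
    then obtain e where e: "e \<noteq> 0" "H x = e \<cdot>\<^sub>v J_poly k x" unfolding proj_def by auto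
    have "q = proj (H x)" unfolding z(1) d(2) by (simp add: proj_smult[OF d(1)])
    also have "\<dots> = proj (J_poly k x)" unfolding e(2) by (rule proj_smult[OF e(1)])
    finally show ?thesis .
  qed
  ultimately have "(THE q. ratmap_val k (J_poly k) (proj x) q) = proj (J_poly k x)"
    by (rule the_equality)
  then show ?thesis using v unfolding J_map_def ratmap_def by metis
qed

lemma J_torus:
  assumes x: "x \<in> carrier_vec (k+1)" and nz: "\<forall>i\<le>k. x $ i \<noteq> 0"
  shows "J_map k (proj x) = Some (proj (vec (k+1) (\<lambda>i. 1 / x $ i)))"
proof -
  let ?P = "\<Prod>j\<le>k. x $ j"
  have P: "?P \<noteq> 0" using nz by auto
  have e: "J_poly k x = ?P \<cdot>\<^sub>v vec (k+1) (\<lambda>i. 1 / x $ i)"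
    by (rule eq_vecI) (use nz in \<open>auto simp: J_poly_def less_Suc_eq_le prod.remove[of "{..k}"]\<close>)
  have "x \<noteq> 0\<^sub>v (k+1)" using nz by auto
  moreover have "J_poly k x \<noteq> 0\<^sub>v (k+1)"
    using P nz x unfolding e by (auto simp: vec_eq_iff)
  ultimately show ?thesis using J_map_at[OF x] e P proj_smult by metis
qed


definition basic_cremona :: "nat \<Rightarrow> (ppoint \<Rightarrow> ppoint) \<Rightarrow> (ppoint \<Rightarrow> ppoint) \<Rightarrow> ppoint \<Rightarrow> ppoint option" where
  "basic_cremona k S T p =
     (if p \<in> PS k then map_option S (J_map k (inv_into (PS k) T p)) else None)"

definition iterate :: "(ppoint \<Rightarrow> ppoint option) \<Rightarrow> nat \<Rightarrow> ppoint \<Rightarrow> ppoint option" where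
  "iterate F m p = ((\<lambda>r. Option.bind r F) ^^ m) (Some p)"


definition gam :: "nat \<Rightarrow> complex \<Rightarrow> ppoint" where
  "gam k t = proj (vec (k + 1) (\<lambda>i. if i < k then t ^ i else t ^ (k + 1)))"

definition gam_inf :: "nat \<Rightarrow> ppoint" where
  "gam_inf k = proj (unit_vec (k + 1) k)"

definition C_reg :: "nat \<Rightarrow> ppoint set" where
  "C_reg k = range (gam k)"

definition curve_C :: "nat \<Rightarrow> ppoint set" where
  "curve_C k = insert (gam_inf k) (C_reg k)"

definition proper_transform :: "nat \<Rightarrow> (ppoint \<Rightarrow> ppoint option) \<Rightarrow> ppoint set \<Rightarrow> ppoint set" where
  "proper_transform k F X = zariski_closure k {the (F p) | p. p \<in> X - indet k F}"

definition centered_on_C :: "nat \<Rightarrow> (ppoint \<Rightarrow> ppoint) \<Rightarrow> bool" where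
  "centered_on_C k T \<longleftrightarrow> (\<forall>j\<le>k. T (pt_e k j) \<in> C_reg k)"

definition properly_fixes_C :: "nat \<Rightarrow> (ppoint \<Rightarrow> ppoint) \<Rightarrow> (ppoint \<Rightarrow> ppoint) \<Rightarrow> bool" where
  "properly_fixes_C k S T \<longleftrightarrow> centered_on_C k T \<and>
     proper_transform k (basic_cremona k S T) (curve_C k) = curve_C k"


text \<open>
  A map on \<open>X\<close> is regular if near each point of \<open>X\<close> (namely where the tuple \<open>G\<close> does not vanish) it
  is given by homogeneous polynomials of equal degree.
\<close>

definition regular_on :: "nat \<Rightarrow> ppoint set \<Rightarrow> (ppoint \<Rightarrow> ppoint) \<Rightarrow> bool" where
  "regular_on k X \<phi> \<longleftrightarrow> (\<forall>p\<in>X. \<phi> p \<in> PS k) \<and>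
     (\<forall>p\<in>X. \<exists>G. hom_map k G \<and> G ` p \<subseteq> \<phi> p \<and>
        (\<forall>q\<in>X. (\<forall>x\<in>q. G x \<noteq> 0\<^sub>v (k + 1)) \<longrightarrow> G ` q \<subseteq> \<phi> q))"

definition automorphism_of :: "nat \<Rightarrow> ppoint set \<Rightarrow> (ppoint \<Rightarrow> ppoint) \<Rightarrow> bool" where
  "automorphism_of k X \<phi> \<longleftrightarrow>
     bij_betw \<phi> X X \<and> regular_on k X \<phi> \<and> regular_on k X (inv_into X \<phi>)"

text \<open>
  \<open>\<phi>\<close> is the automorphism of \<open>X\<close> induced by \<open>F\<close>, written \<open>F|\<^sub>X\<close>. If \<open>X - I(F)\<close> is dense in \<open>X\<close>,
  it is unique; at points of \<open>X \<inter> I(F)\<close> its value is the regular extension.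
\<close>

definition induced_automorphism ::
    "nat \<Rightarrow> (ppoint \<Rightarrow> ppoint option) \<Rightarrow> ppoint set \<Rightarrow> (ppoint \<Rightarrow> ppoint) \<Rightarrow> bool" where
  "induced_automorphism k F X \<phi> \<longleftrightarrow> automorphism_of k X \<phi> \<and>
     (\<forall>p\<in>X - indet k F. F p = Some (\<phi> p))"

end

theory Submission
  imports Defs "HOL-Computational_Algebra.Polynomial"
begin

text \<open>
  Put \<open>\<sigma> = \<Sum> t\<^sub>j\<close>. The \<open>j\<close>-th coordinate of \<open>T\<^sup>-\<^sup>1(\<gamma>(s))\<close> is a multiple of
  \<open>(s + \<sigma> - t\<^sub>j) \<Prod>\<^sub>i\<^sub>\<noteq>\<^sub>j (s - t\<^sub>i)\<close>, so \<open>F(\<gamma>(s)) = \<Sum>\<^sub>j \<beta>\<^sub>j (s - t\<^sub>j)/(s + \<sigma> - t\<^sub>j) S(e\<^sub>j)\<close> for constants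
  \<open>\<beta>\<^sub>j \<noteq> 0\<close>. Equating this with \<open>\<gamma>(\<delta>s + \<tau>)\<close>, \<open>\<tau> = 1 - \<delta>\<close>, gives
  \<open>(k - 1)\<delta>\<sigma> = (k + 1)\<tau>\<close> from the expansion at \<open>s = \<infinity>\<close> and \<open>S(e\<^sub>j) = \<gamma>(\<delta>(t\<^sub>j - \<sigma>) + \<tau>)\<close> from the pole at
  \<open>s = t\<^sub>j - \<sigma>\<close>. By (a) the \<open>t\<^sub>j\<close> then satisfy an affine recursion with multiplier \<open>\<delta>\<close>,
  summing it determines \<open>t\<^sub>0\<close>, and (b) becomes the polynomial equation for \<open>\<delta>\<close>.
\<close>

section \<open>Projective points and basic Cremona maps\<close>

lemma mem_proj_self: "x \<in> proj x"
  unfolding proj_def by (auto intro!: exI[of _ 1])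

lemma image_proj:
  assumes "A \<in> carrier_mat n m" "x \<in> carrier_vec m"
  shows "(\<lambda>x. A *\<^sub>v x) ` proj x = proj (A *\<^sub>v x)"
proof -
  have "A *\<^sub>v (c \<cdot>\<^sub>v x) = c \<cdot>\<^sub>v (A *\<^sub>v x)" for c
    using assms by (rule mult_mat_vec)
  then show ?thesis unfolding proj_def setcompr_eq_image image_image by simp
qed

lemma proj_eqD:
  assumes "proj x = proj y"
  obtains c where "c \<noteq> 0" "x = c \<cdot>\<^sub>v y"
  using mem_proj_self[of x] unfolding assms by (auto simp: proj_def)

text \<open>The left inverse \<open>A'\<close> makes \<open>T\<close> injective on
  \<open>PS k\<close>, so \<open>inv_into\<close> really returns the preimage \<open>proj x\<close>.
  With all coordinates of \<open>x\<close> nonzero, \<open>J\<close> just inverts them.\<close>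

lemma basic_cremona_torus:
  assumes A: "A \<in> carrier_mat (k+1) (k+1)" "A' \<in> carrier_mat (k+1) (k+1)" "A' * A = 1\<^sub>m (k+1)"
    and B: "B \<in> carrier_mat (k+1) (k+1)"
    and T: "T = (\<lambda>p. (\<lambda>x. A *\<^sub>v x) ` p)" and S: "S = (\<lambda>p. (\<lambda>x. B *\<^sub>v x) ` p)"
    and x: "x \<in> carrier_vec (k+1)" "\<forall>i\<le>k. x $ i \<noteq> 0"
  shows "basic_cremona k S T (proj (A *\<^sub>v x)) =
    Some (proj (B *\<^sub>v vec (k+1) (\<lambda>i. 1 / x $ i)))"
proof -
  have inv: "A' *\<^sub>v (A *\<^sub>v y) = y" if "y \<in> carrier_vec (k+1)" for y
    using A that by (metis assoc_mult_mat_vec one_mult_mat_vec)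
  have "inj_on T (PS k)"
  proof (rule inj_onI)
    fix p q assume p: "p \<in> PS k" and q: "q \<in> PS k" and e: "T p = T q"
    have "(\<lambda>y. A' *\<^sub>v y) ` T p = p" if p: "p \<in> PS k" for p
    proof -
      obtain y where y: "p = proj y" "y \<in> carrier_vec (k+1)"
        using p unfolding PS_def by blast
      have "T p = proj (A *\<^sub>v y)" unfolding T y(1) by (rule image_proj[OF A(1) y(2)])
      moreover have "(\<lambda>z. A' *\<^sub>v z) ` proj (A *\<^sub>v y) = proj (A' *\<^sub>v (A *\<^sub>v y))"
        by (rule image_proj[OF A(2)]) (use A y in auto)
      ultimately show ?thesis using inv[OF y(2)] y(1) by simp
    qed
    then show "p = q" using p q e by metis
  qed
  moreover have x0: "x \<noteq> 0\<^sub>v (k+1)" using x by auto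
  then have "proj x \<in> PS k" using x unfolding PS_def by auto
  moreover have "T (proj x) = proj (A *\<^sub>v x)" unfolding T by (rule image_proj) (use A x in auto)
  ultimately have "inv_into (PS k) T (proj (A *\<^sub>v x)) = proj x"
    by (metis inv_into_f_f)
  moreover have "A *\<^sub>v x \<noteq> 0\<^sub>v (k+1)"
  proof
    assume "A *\<^sub>v x = 0\<^sub>v (k+1)"
    then have "x = A' *\<^sub>v 0\<^sub>v (k+1)" using inv[OF x(1)] by simp
    then show False using x0 A(2) by (auto simp: vec_eq_iff scalar_prod_def)
  qed
  then have "proj (A *\<^sub>v x) \<in> PS k" using A x unfolding PS_def by force
  ultimately show ?thesis
    using J_torus[OF x] image_proj[OF B, of "vec (k+1) (\<lambda>i. 1 / x $ i)"]
    unfolding basic_cremona_def S by simp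
qed

section \<open>Polynomials with prescribed roots\<close>

text \<open>Induction adding one factor at a time. Writing \<open>Suc m = card I\<close> instead of
  \<open>m = card I - 1\<close> avoids truncated subtraction for the empty product.\<close>

lemma coeff_prod_monic_linear:
  fixes a :: "'i \<Rightarrow> 'a :: comm_ring_1"
  assumes "finite I"
  shows "coeff (\<Prod>i\<in>I. [:a i, 1:]) (card I) = 1 \<and>
    (\<forall>m>card I. coeff (\<Prod>i\<in>I. [:a i, 1:]) m = 0) \<and>
    (\<forall>m. Suc m = card I \<longrightarrow> coeff (\<Prod>i\<in>I. [:a i, 1:]) m = (\<Sum>i\<in>I. a i))"
  using assms
proof (induction I rule: finite_induct)
  case empty
  then show ?case by (auto simp: coeff_pCons split: nat.splits)
next
  case (insert x I)
  have "coeff (\<Prod>i\<in>I. [:a i, 1:]) (card I - Suc 0) = (\<Sum>i\<in>I. a i)" if "0 < card I"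
    using insert.IH that by auto
  with insert show ?case
    by (cases "I = {}") (auto simp: coeff_pCons algebra_simps card_gt_0_iff split: nat.splits)
qed

text \<open>The vanishing next-to-top coefficient forces the roots to sum to zero, which locates the
  remaining root.\<close>

lemma poly_eq_prod_roots_trace_zero:
  fixes q :: "'a :: idom poly"
  assumes I: "finite I" "inj_on r I"
    and deg: "degree q \<le> card I + 1" and co: "coeff q (card I) = 0"
    and root: "\<And>i. i \<in> I \<Longrightarrow> poly q (r i) = 0"
  shows "q = smult (coeff q (card I + 1)) ((\<Prod>i\<in>I. [:- r i, 1:]) * [:\<Sum>i\<in>I. r i, 1:])"
proof (rule ccontr)
  let ?P = "\<Prod>i\<in>I. [:- r i, 1:]"
  let ?R = "?P * [:\<Sum>i\<in>I. r i, 1:]"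
  define d where "d = q - smult (coeff q (card I + 1)) ?R"
  assume "\<not> ?thesis"
  then have d0: "d \<noteq> 0" by (auto simp: d_def)
  note P = coeff_prod_monic_linear[OF I(1), of "\<lambda>i. - r i"]
  have R: "coeff ?R (card I + 1) = 1" "coeff ?R (card I) = 0" "\<And>m. m > card I + 1 \<Longrightarrow> coeff ?R m = 0"
    subgoal using P by (simp add: coeff_pCons)
    subgoal using P I by (cases "card I") (auto simp: coeff_pCons sum_negf)
    subgoal for m using P by (cases m) (auto simp: coeff_pCons)
    done
  \<comment> \<open>Both sides agree in degrees \<open>card I\<close> and \<open>card I + 1\<close>,
    so \<open>d\<close> has degree below \<open>card I\<close> and still vanishes at the
    \<open>card I\<close> distinct points \<open>r i\<close>.\<close>
  have "coeff d m = 0" if "m \<ge> card I" for m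
  proof -
    consider "m = card I" | "m = card I + 1" | "m > card I + 1" using \<open>m \<ge> card I\<close> by linarith
    then show ?thesis
      using R co deg by cases (auto simp: d_def coeff_eq_0)
  qed
  then have "degree d < card I"
    using d0 by (metis leading_coeff_0_iff not_le)
  moreover have "poly ?P (r i) = 0" if "i \<in> I" for i
    using I(1) that by (auto simp: poly_prod intro!: prod_zero)
  then have "r ` I \<subseteq> {x. poly d x = 0}"
    using root by (simp add: d_def image_subset_iff)
  then have "card I \<le> card {x. poly d x = 0}"
    using I card_mono[OF poly_roots_finite[OF d0]] by (metis card_image)
  ultimately show False using card_poly_roots_bound[OF d0] by linarith
qed

lemma poly_eqI_cofinite:
  fixes p q :: "'a :: {idom, ring_char_0} poly"
  assumes "finite X" "\<And>x. x \<notin> X \<Longrightarrow> poly p x = poly q x"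
  shows "p = q"
proof (rule ccontr)
  assume "p \<noteq> q"
  then have "finite {x. poly (p - q) x = 0}" by (intro poly_roots_finite) auto
  moreover have "UNIV \<subseteq> X \<union> {x. poly (p - q) x = 0}" using assms(2) by auto
  ultimately show False using assms(1) infinite_UNIV_char_0 finite_subset by blast
qed

section \<open>The cuspidal curve\<close>

definition gam_vec :: "nat \<Rightarrow> complex \<Rightarrow> complex vec" where
  "gam_vec k s = vec (k+1) (\<lambda>i. if i < k then s ^ i else s ^ (k + 1))"

lemma gam_vec_carrier [simp]: "gam_vec k s \<in> carrier_vec (k+1)"
  by (simp add: gam_vec_def)

lemma dim_gam_vec [simp]: "dim_vec (gam_vec k s) = k+1"
  by (simp add: gam_vec_def)

lemma gam_eq_proj: "gam k s = proj (gam_vec k s)"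
  by (simp add: gam_def gam_vec_def)

text \<open>Coordinate 0 is 1 and, as \<open>k \<ge> 2\<close>, coordinate 1 is the parameter
  itself; the first fixes the scalar, the second the parameter.\<close>

lemma gam_inject:
  assumes k: "k \<ge> 2" and e: "gam k s = gam k u"
  shows "s = u"
proof -
  obtain c where c: "c \<noteq> 0" "gam_vec k s = c \<cdot>\<^sub>v gam_vec k u"
    using e unfolding gam_eq_proj by (rule proj_eqD)
  have "gam_vec k r $ 0 = 1" "gam_vec k r $ 1 = r" for r
    using k by (auto simp: gam_vec_def)
  moreover have "gam_vec k s $ i = c * gam_vec k u $ i" if "i \<le> k" for i
    unfolding c(2) using that by simp
  ultimately show ?thesis using k
    by (metis le_trans mult.right_neutral mult_1 one_le_numeral zero_le)
qed

lemma induced_automorphism_gam: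
  assumes "induced_automorphism k F (curve_C k) F_C" "gam k s \<notin> indet k F"
  shows "F (gam k s) = Some (F_C (gam k s))"
proof -
  have "gam k s \<in> curve_C k - indet k F"
    using assms(2) by (simp add: curve_C_def C_reg_def)
  then show ?thesis using assms(1) unfolding induced_automorphism_def by blast
qed

text \<open>In the basis of \<open>k + 1\<close> points of the curve, the \<open>j\<close>-th coordinate of \<open>\<gamma>(s)\<close> is a polynomial
  in \<open>s\<close> of degree at most \<open>k + 1\<close> without \<open>s\<^sup>k\<close>-term, vanishing at the parameters of the other points.\<close>

lemma gam_vec_coords:
  assumes M: "M \<in> carrier_mat (k+1) (k+1)"
    and d: "\<And>i. i \<le> k \<Longrightarrow> d i \<noteq> 0 \<and> M *\<^sub>v gam_vec k (t i) = d i \<cdot>\<^sub>v unit_vec (k+1) i"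
    and \<sigma>: "\<sigma> = (\<Sum>i\<le>k. t i)"
  obtains \<alpha> where "inj_on t {..k}" "\<sigma> \<noteq> 0" "\<And>j. j \<le> k \<Longrightarrow> \<alpha> j \<noteq> 0"
    "\<And>j s. j \<le> k \<Longrightarrow>
      (M *\<^sub>v gam_vec k s) $ j = \<alpha> j * ((\<Prod>i\<in>{..k} - {j}. s - t i) * (s + \<sigma> - t j))"
proof -
  define q where "q j = (\<Sum>i\<le>k. monom (M $$ (j,i)) (if i < k then i else k + 1))" for j
  have q: "poly (q j) s = (M *\<^sub>v gam_vec k s) $ j" if "j \<le> k" for j s
  proof -
    have "(M *\<^sub>v gam_vec k s) $ j = (\<Sum>i\<in>{0..<k+1}. M $$ (j,i) * gam_vec k s $ i)"
      using M that by (auto simp: scalar_prod_def intro!: sum.cong)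
    also have "{0..<k+1} = {..k}" by auto
    also have "(\<Sum>i\<le>k. M $$ (j,i) * gam_vec k s $ i) = poly (q j) s"
      unfolding q_def poly_sum by (rule sum.cong) (auto simp: gam_vec_def poly_monom)
    finally show ?thesis ..
  qed
  have q_t: "poly (q j) (t i) = (if i = j then d i else 0)" if "i \<le> k" "j \<le> k" for i j
    using q[OF that(2), of "t i"] d[OF that(1)] that by auto
  have inj: "inj_on t {..k}"
  proof (rule inj_onI)
    fix i j assume *: "i \<in> {..k}" "j \<in> {..k}" "t i = t j"
    then have "poly (q j) (t i) \<noteq> 0" using q_t[of j j] d[of j] by auto
    then show "i = j" using q_t[of i j] * by (auto split: if_splits)
  qed
  define \<alpha> where "\<alpha> j = coeff (q j) (k+1)" for j
  have form: "poly (q j) s = \<alpha> j * ((\<Prod>i\<in>{..k} - {j}. s - t i) * (s + \<sigma> - t j))"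
    if j: "j \<le> k" for j s
  proof -
    let ?I = "{..k} - {j}"
    have card: "card ?I = k" using j by simp
    have sum: "(\<Sum>i\<in>?I. t i) = \<sigma> - t j"
      using j unfolding \<sigma> by (simp add: sum_diff1)
    have deg: "degree (q j) \<le> k + 1"
      unfolding q_def by (rule degree_sum_le) (auto intro: order_trans[OF degree_monom_le])
    have co: "coeff (q j) k = 0"
      unfolding q_def coeff_sum by (rule sum.neutral) auto
    have "q j = smult (coeff (q j) (card ?I + 1)) ((\<Prod>i\<in>?I. [:- t i, 1:]) * [:\<Sum>i\<in>?I. t i, 1:])"
    proof (rule poly_eq_prod_roots_trace_zero)
      show "poly (q j) (t i) = 0" if "i \<in> ?I" for i using q_t[of i j] that j by auto
    qed (use inj card deg co in \<open>auto intro: inj_on_subset\<close>)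
    then have "q j = smult (\<alpha> j) ((\<Prod>i\<in>?I. [:- t i, 1:]) * [:\<sigma> - t j, 1:])"
      unfolding card sum \<alpha>_def .
    then have "poly (q j) s = poly (smult (\<alpha> j) ((\<Prod>i\<in>?I. [:- t i, 1:]) * [:\<sigma> - t j, 1:])) s"
      by simp
    then show ?thesis by (simp add: poly_prod algebra_simps)
  qed
  \<comment> \<open>At \<open>s = t j\<close> the last factor becomes \<open>\<sigma>\<close>, while
    the value is \<open>d j\<close>, which is nonzero.\<close>
  have nz: "\<alpha> j \<noteq> 0" "\<sigma> \<noteq> 0" if "j \<le> k" for j
    using form[OF that, of "t j"] q_t[OF that that] d[OF that] by auto
  show ?thesis
    by (rule that[of \<alpha>]) (use inj nz form q in \<open>auto simp del: index_mult_mat_vec\<close>)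
qed

section \<open>Clearing denominators along the curve\<close>

text \<open>The lift of \<open>s \<mapsto> F(\<gamma>(s))\<close> obtained by clearing denominators.\<close>

definition image_lift :: "nat \<Rightarrow> complex mat \<Rightarrow> (nat \<Rightarrow> complex) \<Rightarrow> (nat \<Rightarrow> complex) \<Rightarrow> nat \<Rightarrow> complex poly" where
  "image_lift k B \<alpha> t i = (\<Sum>j\<le>k. smult (B $$ (i,j) / \<alpha> j)
     ([:- t j, 1:] * (\<Prod>l\<in>{..k} - {j}. [:(\<Sum>l\<le>k. t l) - t l, 1:])))"

text \<open>Each summand is a product of \<open>k + 1\<close> monic linear factors whose constant
  terms add up to \<open>(k - 1) * \<sigma>\<close>: the \<open>- t j\<close> of the first factor
  cancels the \<open>t j\<close> left by omitting the factor with index \<open>j\<close>. So the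
  ratio of the two top coefficients does not depend on \<open>j\<close>.\<close>

lemma coeff_image_lift:
  shows "m > k + 1 \<Longrightarrow> coeff (image_lift k B \<alpha> t i) m = 0"
    and "coeff (image_lift k B \<alpha> t i) (k + 1) = (\<Sum>j\<le>k. B $$ (i,j) / \<alpha> j)"
    and "k \<ge> 1 \<Longrightarrow> coeff (image_lift k B \<alpha> t i) k =
      of_nat (k - 1) * (\<Sum>l\<le>k. t l) * (\<Sum>j\<le>k. B $$ (i,j) / \<alpha> j)"
proof -
  define \<sigma> where "\<sigma> = (\<Sum>l\<le>k. t l)"
  define R where "R j = (\<Prod>l\<in>{..k} - {j}. [:\<sigma> - t l, 1:])" for j
  have G: "image_lift k B \<alpha> t i = (\<Sum>j\<le>k. smult (B $$ (i,j) / \<alpha> j) ([:- t j, 1:] * R j))"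
    unfolding image_lift_def R_def \<sigma>_def ..
  have R: "coeff (R j) k = 1" "\<And>m. m > k \<Longrightarrow> coeff (R j) m = 0"
    "\<And>m. Suc m = k \<Longrightarrow> coeff (R j) m = of_nat (k - 1) * \<sigma> + t j" if "j \<le> k" for j
  proof -
    have card: "card ({..k} - {j}) = k" using that by simp
    note c = coeff_prod_monic_linear[of "{..k} - {j}" "\<lambda>l. \<sigma> - t l", unfolded card, folded R_def]
    have "(\<Sum>l\<in>{..k} - {j}. \<sigma> - t l) = (\<Sum>l\<le>k. \<sigma> - t l) - (\<sigma> - t j)"
      using that by (simp add: sum_diff1)
    also have "\<dots> = of_nat k * \<sigma> - \<sigma> + t j"
      by (simp add: sum_subtractf \<sigma>_def[symmetric] algebra_simps)
    finally have s: "(\<Sum>l\<in>{..k} - {j}. \<sigma> - t l) = of_nat k * \<sigma> - \<sigma> + t j" .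
    show "coeff (R j) k = 1" "\<And>m. m > k \<Longrightarrow> coeff (R j) m = 0" using c by auto
    show "\<And>m. Suc m = k \<Longrightarrow> coeff (R j) m = of_nat (k - 1) * \<sigma> + t j"
      using c s by (auto simp: algebra_simps)
  qed
  show "coeff (image_lift k B \<alpha> t i) m = 0" if "m > k + 1"
    unfolding G coeff_sum using that R by (intro sum.neutral) (auto simp: coeff_pCons split: nat.splits)
  show "coeff (image_lift k B \<alpha> t i) (k + 1) = (\<Sum>j\<le>k. B $$ (i,j) / \<alpha> j)"
    unfolding G coeff_sum by (rule sum.cong) (auto simp: coeff_pCons R)
  show "coeff (image_lift k B \<alpha> t i) k =
      of_nat (k - 1) * (\<Sum>l\<le>k. t l) * (\<Sum>j\<le>k. B $$ (i,j) / \<alpha> j)" if "k \<ge> 1"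
    unfolding G coeff_sum \<sigma>_def[symmetric] sum_distrib_left
  proof (rule sum.cong)
    fix j assume "j \<in> {..k}"
    then have j: "j \<le> k" by simp
    have "coeff ([:- t j, 1:] * R j) k = - t j * coeff (R j) k + coeff (R j) (k - 1)"
      using that by (cases k) (auto simp: coeff_pCons)
    then show "coeff (smult (B $$ (i,j) / \<alpha> j) ([:- t j, 1:] * R j)) k =
      of_nat (k - 1) * \<sigma> * (B $$ (i,j) / \<alpha> j)"
      using R(1)[OF j] R(3)[OF j, of "k - 1"] that by simp
  qed simp
qed

text \<open>Dividing the common factor by \<open>x j\<close> cancels everything except
  \<open>(s - t j) / \<alpha> j\<close> and the product of the \<open>s + \<sigma> - t l\<close>
  over \<open>l \<noteq> j\<close>.\<close>

lemma poly_image_lift: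
  assumes \<alpha>: "\<And>j. j \<le> k \<Longrightarrow> \<alpha> j \<noteq> 0" and \<sigma>: "\<sigma> = (\<Sum>l\<le>k. t l)"
    and s: "\<forall>j\<le>k. s \<noteq> t j \<and> s + \<sigma> \<noteq> t j"
    and x: "\<And>j. j \<le> k \<Longrightarrow> x j = \<alpha> j * ((\<Prod>i\<in>{..k} - {j}. s - t i) * (s + \<sigma> - t j))"
  shows "poly (image_lift k B \<alpha> t i) s =
    (\<Prod>j\<le>k. (s - t j) * (s + \<sigma> - t j)) * (\<Sum>j\<le>k. B $$ (i,j) * (1 / x j))"
  unfolding image_lift_def poly_sum sum_distrib_left \<sigma>[symmetric]
proof (rule sum.cong)
  fix j assume "j \<in> {..k}"
  then have j: "j \<le> k" by simp
  let ?P = "\<Prod>i\<in>{..k} - {j}. s - t i" and ?Q = "\<Prod>i\<in>{..k} - {j}. s + \<sigma> - t i"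
  have nz: "?P \<noteq> 0" "s + \<sigma> - t j \<noteq> 0" using s j by (auto simp: prod_zero_iff)
  have "(\<Prod>j\<le>k. (s - t j) * (s + \<sigma> - t j)) = (s - t j) * (s + \<sigma> - t j) * (?P * ?Q)"
    using j by (simp add: prod.remove[of "{..k}" j] prod.distrib)
  moreover have "poly (\<Prod>l\<in>{..k} - {j}. [:\<sigma> - t l, 1:]) s = ?Q"
    by (simp add: poly_prod add_diff_eq add.commute)
  moreover have "b / a * ((- e + s * 1) * q) = (s - e) * f * (p * q) * (b * (1 / (a * (p * f))))"
    if "p \<noteq> 0" "f \<noteq> 0" "a \<noteq> 0" for a b e f p q :: complex
    using that by (simp add: field_simps)
  ultimately show "poly (smult (B $$ (i,j) / \<alpha> j) ([:- t j, 1:] * (\<Prod>l\<in>{..k} - {j}. [:\<sigma> - t l, 1:]))) s =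
    (\<Prod>j\<le>k. (s - t j) * (s + \<sigma> - t j)) * (B $$ (i,j) * (1 / x j))"
    using nz \<alpha>[OF j] unfolding x[OF j] poly_smult poly_mult by simp
qed simp

text \<open>Every summand with index other than \<open>j\<close> contains the factor that vanishes
  at this point, so only column \<open>j\<close> of \<open>B\<close> survives.\<close>

lemma poly_image_lift_node:
  assumes j: "j \<le> k"
  shows "poly (image_lift k B \<alpha> t i) (t j - (\<Sum>l\<le>k. t l)) =
    - (\<Sum>l\<le>k. t l) * (\<Prod>l\<in>{..k} - {j}. t j - t l) / \<alpha> j * B $$ (i,j)"
proof -
  define \<sigma> where "\<sigma> = (\<Sum>l\<le>k. t l)"
  let ?f = "\<lambda>m. poly (smult (B $$ (i,m) / \<alpha> m)
    ([:- t m, 1:] * (\<Prod>l\<in>{..k} - {m}. [:\<sigma> - t l, 1:]))) (t j - \<sigma>)"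
  have "?f m = 0" if "m \<in> {..k} - {j}" for m
    using that j by (auto simp: poly_prod prod_zero_iff)
  then have "(\<Sum>m\<in>{..k} - {j}. ?f m) = 0" by (intro sum.neutral ballI)
  moreover have "(\<Sum>m\<le>k. ?f m) = ?f j + (\<Sum>m\<in>{..k} - {j}. ?f m)"
    by (rule sum.remove) (use j in auto)
  moreover have "poly (\<Prod>l\<in>{..k} - {j}. [:\<sigma> - t l, 1:]) (t j - \<sigma>) = (\<Prod>l\<in>{..k} - {j}. t j - t l)"
    by (simp add: poly_prod)
  ultimately show ?thesis
    unfolding image_lift_def poly_sum \<sigma>_def[symmetric] poly_smult poly_mult by simp
qed

text \<open>Comparing degrees, the lift of \<open>s \<mapsto> F(\<gamma>(s)) = \<gamma>(\<delta>s + \<tau>)\<close> is a constant multiple of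
  \<open>(1, u, \<dots>, u\<^sup>k\<^sup>-\<^sup>1, u\<^sup>k\<^sup>+\<^sup>1)\<close> with \<open>u = \<delta>s + \<tau>\<close>. Its two top coefficients give the first relation, its value
  at \<open>s = t\<^sub>j - \<sigma>\<close>, where \<open>\<gamma>(s)\<close> lies on the hyperplane contracted to \<open>S(e\<^sub>j)\<close>, the second.\<close>

lemma cremona_curve_relations:
  fixes t :: "nat \<Rightarrow> complex"
  assumes k: "k \<ge> 2" and S: "S \<in> Aut_PS k" and T: "T \<in> Aut_PS k"
    and ind: "induced_automorphism k (basic_cremona k S T) (curve_C k) F_C"
    and F_C: "\<And>s. F_C (gam k s) = gam k (\<delta> * s + \<tau>)" and \<delta>: "\<delta> \<noteq> 0"
    and t: "\<And>j. j \<le> k \<Longrightarrow> gam k (t j) = T (pt_e k j)"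
    and \<sigma>: "\<sigma> = (\<Sum>j\<le>k. t j)"
  shows "of_nat (k - 1) * \<sigma> * \<delta> = of_nat (k + 1) * \<tau>"
    and "\<And>j. j \<le> k \<Longrightarrow> S (pt_e k j) = gam k (\<delta> * (t j - \<sigma>) + \<tau>)"
proof -
  obtain A where A: "A \<in> carrier_mat (k+1) (k+1)" "invertible_mat A"
    and TA: "T = (\<lambda>p. (\<lambda>x. A *\<^sub>v x) ` p)"
    using T unfolding Aut_PS_def by auto
  obtain B where B: "B \<in> carrier_mat (k+1) (k+1)" "invertible_mat B"
    and SB: "S = (\<lambda>p. (\<lambda>x. B *\<^sub>v x) ` p)"
    using S unfolding Aut_PS_def by auto
  obtain A' where A': "A' \<in> carrier_mat (k+1) (k+1)" "A' * A = 1\<^sub>m (k+1)" "A * A' = 1\<^sub>m (k+1)"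
  proof -
    obtain M where M: "A * M = 1\<^sub>m (k+1)" "M * A = 1\<^sub>m (dim_row M)"
      using A unfolding invertible_mat_def inverts_mat_def by auto
    have "dim_col M = k + 1" using arg_cong[OF M(1), of dim_col] by simp
    moreover have "dim_row M = k + 1" using arg_cong[OF M(2), of dim_col] A by simp
    ultimately show ?thesis using that[of M] M by auto
  qed
  have inv: "A' *\<^sub>v (A *\<^sub>v y) = y" "A *\<^sub>v (A' *\<^sub>v y) = y" if "y \<in> carrier_vec (k+1)" for y
    using A(1) A' that by (metis assoc_mult_mat_vec one_mult_mat_vec)+
  have "\<exists>d. d \<noteq> 0 \<and> A' *\<^sub>v gam_vec k (t i) = d \<cdot>\<^sub>v unit_vec (k+1) i" if i: "i \<le> k" for i
  proof -
    have "proj (gam_vec k (t i)) = proj (A *\<^sub>v unit_vec (k+1) i)"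
      using t[OF i] image_proj[OF A(1), of "unit_vec (k+1) i"]
      unfolding gam_eq_proj TA pt_e_def by simp
    then obtain d where d: "d \<noteq> 0" "gam_vec k (t i) = d \<cdot>\<^sub>v (A *\<^sub>v unit_vec (k+1) i)"
      by (rule proj_eqD)
    then show ?thesis
      using inv(1)[of "unit_vec (k+1) i"] A(1) A'(1)
      by (intro exI[of _ d]) (simp add: mult_mat_vec[of _ "k+1" "k+1"])
  qed
  then obtain d where d: "\<And>i. i \<le> k \<Longrightarrow> d i \<noteq> 0 \<and> A' *\<^sub>v gam_vec k (t i) = d i \<cdot>\<^sub>v unit_vec (k+1) i"
    by metis
  obtain \<alpha> where inj: "inj_on t {..k}" and \<sigma>0: "\<sigma> \<noteq> 0" and \<alpha>: "\<And>j. j \<le> k \<Longrightarrow> \<alpha> j \<noteq> 0"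
    and coords: "\<And>j s. j \<le> k \<Longrightarrow>
      (A' *\<^sub>v gam_vec k s) $ j = \<alpha> j * ((\<Prod>i\<in>{..k} - {j}. s - t i) * (s + \<sigma> - t j))"
    using gam_vec_coords[OF A'(1) d \<sigma>] by metis
  define G where "G = image_lift k B \<alpha> t"
  define u where "u = [:\<tau>, \<delta>:]"
  \<comment> \<open>These are the parameters at which some coordinate of
    \<open>T\<^sup>-\<^sup>1(\<gamma>(s))\<close> vanishes; elsewhere \<open>J\<close> acts by
    inverting coordinates.\<close>
  define X where "X = t ` {..k} \<union> (\<lambda>j. t j - \<sigma>) ` {..k}"
  have fin: "finite X" by (simp add: X_def)
  have generic: "\<exists>c. c \<noteq> 0 \<and> vec (k+1) (\<lambda>i. poly (G i) s) = c \<cdot>\<^sub>v gam_vec k (poly u s)"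
    if s: "s \<notin> X" for s
  proof -
    let ?x = "A' *\<^sub>v gam_vec k s"
    let ?y = "vec (k+1) (\<lambda>i. 1 / ?x $ i)"
    let ?N = "\<Prod>j\<le>k. (s - t j) * (s + \<sigma> - t j)"
    have s': "\<forall>j\<le>k. s \<noteq> t j \<and> s + \<sigma> \<noteq> t j"
      using s unfolding X_def by (auto simp: image_iff eq_diff_eq)
    have xc: "?x \<in> carrier_vec (k+1)"
      by (rule mult_mat_vec_carrier[OF A'(1) gam_vec_carrier])
    have x0: "\<forall>j\<le>k. ?x $ j \<noteq> 0"
      using coords \<alpha> s' by (auto simp: prod_zero_iff simp del: index_mult_mat_vec)
    have N0: "?N \<noteq> 0" using s' by (auto simp: prod_zero_iff)
    have "basic_cremona k S T (gam k s) = Some (proj (B *\<^sub>v ?y))"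
      using basic_cremona_torus[OF A(1) A'(1,2) B(1) TA SB xc x0] inv(2)[OF gam_vec_carrier, of s]
      unfolding gam_eq_proj by simp
    moreover from this have "gam k s \<notin> indet k (basic_cremona k S T)"
      by (simp add: indet_def)
    then have "basic_cremona k S T (gam k s) = Some (gam k (\<delta> * s + \<tau>))"
      unfolding F_C[symmetric] by (rule induced_automorphism_gam[OF ind])
    moreover have "poly u s = \<delta> * s + \<tau>" by (simp add: u_def mult.commute)
    ultimately have "proj (B *\<^sub>v ?y) = proj (gam_vec k (poly u s))"
      unfolding gam_eq_proj by simp
    then obtain c where c: "c \<noteq> 0" "B *\<^sub>v ?y = c \<cdot>\<^sub>v gam_vec k (poly u s)"
      by (rule proj_eqD)
    have "vec (k+1) (\<lambda>i. poly (G i) s) = ?N \<cdot>\<^sub>v (B *\<^sub>v ?y)"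
    proof (rule eq_vecI)
      fix i assume "i < dim_vec (?N \<cdot>\<^sub>v (B *\<^sub>v ?y))"
      then have i: "i \<le> k" using B(1) by simp
      have "(B *\<^sub>v ?y) $ i = (\<Sum>j\<in>{0..<k+1}. B $$ (i,j) * (1 / ?x $ j))"
        using B(1) i by (auto simp: scalar_prod_def simp del: index_mult_mat_vec(1)
            simp add: index_mult_mat_vec(1)[of i B] intro!: sum.cong)
      also have "{0..<k+1} = {..k}" by auto
      finally have By: "(B *\<^sub>v ?y) $ i = (\<Sum>j\<le>k. B $$ (i,j) * (1 / ?x $ j))" .
      have "poly (G i) s = ?N * (\<Sum>j\<le>k. B $$ (i,j) * (1 / ?x $ j))"
        unfolding G_def by (rule poly_image_lift[OF \<alpha> \<sigma> s' coords])
      then show "vec (k+1) (\<lambda>i. poly (G i) s) $ i = (?N \<cdot>\<^sub>v (B *\<^sub>v ?y)) $ i"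
        using By B(1) i by (simp del: index_mult_mat_vec)
    qed (use B(1) in simp)
    then show ?thesis using c N0
      by (intro exI[of _ "?N * c"]) (simp add: smult_smult_assoc)
  qed
  have val: "poly (G i) s = poly (G 0) s * poly u s ^ (if i < k then i else k + 1)" "poly (G 0) s \<noteq> 0"
    if s: "s \<notin> X" and i: "i \<le> k" for i s
  proof -
    obtain c where c: "c \<noteq> 0" "vec (k+1) (\<lambda>i. poly (G i) s) = c \<cdot>\<^sub>v gam_vec k (poly u s)"
      using generic[OF s] by blast
    have G: "poly (G i) s = c * poly u s ^ (if i < k then i else k + 1)" if "i \<le> k" for i
    proof -
      have "poly (G i) s = vec (k+1) (\<lambda>i. poly (G i) s) $ i" using that by simp
      then show ?thesis unfolding c(2) using that by (simp add: gam_vec_def)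
    qed
    have c': "poly (G 0) s = c" using G[of 0] k by simp
    show "poly (G i) s = poly (G 0) s * poly u s ^ (if i < k then i else k + 1)"
      unfolding c' by (rule G[OF i])
    show "poly (G 0) s \<noteq> 0" unfolding c' by (rule c(1))
  qed
  have G_eq: "G i = G 0 * u ^ (if i < k then i else k + 1)" if "i \<le> k" for i
    by (rule poly_eqI_cofinite[OF fin]) (use val(1)[OF _ that] in \<open>simp add: poly_power\<close>)
  obtain s0 where "s0 \<notin> X"
    using fin infinite_UNIV_char_0 by (metis ex_new_if_finite)
  then have G0: "G 0 \<noteq> 0" using val(2)[of s0 0] by auto
  have u0: "u \<noteq> 0" "degree u = 1" using \<delta> by (auto simp: u_def)
  have Gk: "G k = G 0 * u ^ (k+1)" using G_eq[of k] by simp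
  \<comment> \<open>The factor \<open>u ^ (k+1)\<close> already uses up the whole degree bound,
    which forces \<open>G 0\<close> to be constant.\<close>
  have "degree (G k) \<le> k + 1"
    unfolding G_def by (intro degree_le) (use coeff_image_lift(1) in auto)
  then have "degree (G 0) = 0"
    using G0 u0 unfolding Gk by (simp add: degree_mult_eq degree_power_eq)
  then obtain g where g: "G 0 = [:g:]" by (rule degree_eq_zeroE)
  with G0 have g0: "g \<noteq> 0" by auto
  \<comment> \<open>\<open>b\<close> is the top coefficient of \<open>G k = g * u ^ (k+1)\<close>.
    Comparing the coefficients of degree \<open>k + 1\<close> and \<open>k\<close> and eliminating
    \<open>b\<close> gives the first relation.\<close>
  define b where "b = (\<Sum>j\<le>k. B $$ (k,j) / \<alpha> j)"
  have "b = g * \<delta> ^ (k + 1)"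
    using coeff_image_lift(2)[of k B \<alpha> t k] unfolding G_def[symmetric] Gk g b_def u_def
    by (simp add: coeff_linear_poly_power del: power_Suc)
  moreover have "of_nat (k - 1) * \<sigma> * b = g * (of_nat (k + 1) * \<delta> ^ k * \<tau>)"
    using coeff_image_lift(3)[of k B \<alpha> t k] k unfolding G_def[symmetric] Gk g b_def u_def \<sigma>
    by (simp add: coeff_linear_poly_power del: power_Suc)
  ultimately have "g * \<delta> ^ k * (of_nat (k - 1) * \<sigma> * \<delta>) = g * \<delta> ^ k * (of_nat (k + 1) * \<tau>)"
    by (simp add: algebra_simps)
  then show "of_nat (k - 1) * \<sigma> * \<delta> = of_nat (k + 1) * \<tau>"
    using g0 \<delta> by (metis mult_left_cancel mult_eq_0_iff power_not_zero)
  show "S (pt_e k j) = gam k (\<delta> * (t j - \<sigma>) + \<tau>)" if j: "j \<le> k" for j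
  proof -
    define c where "c = - \<sigma> * (\<Prod>l\<in>{..k} - {j}. t j - t l) / \<alpha> j"
    \<comment> \<open>Since \<open>\<sigma> \<noteq> 0\<close> and the \<open>t l\<close> are
      distinct, the lift does not vanish at the node and represents the point
      \<open>S (pt_e k j)\<close> there.\<close>
    have c0: "c \<noteq> 0"
      using \<sigma>0 \<alpha>[OF j] inj j by (auto simp: c_def prod_zero_iff inj_on_def)
    have "c \<cdot>\<^sub>v (B *\<^sub>v unit_vec (k+1) j) = g \<cdot>\<^sub>v gam_vec k (\<delta> * (t j - \<sigma>) + \<tau>)"
    proof (rule eq_vecI)
      fix i assume "i < dim_vec (g \<cdot>\<^sub>v gam_vec k (\<delta> * (t j - \<sigma>) + \<tau>))"
      then have i: "i \<le> k" by simp
      have "(B *\<^sub>v unit_vec (k+1) j) $ i = B $$ (i,j)" using B(1) i j by simp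
      moreover have "poly (G i) (t j - \<sigma>) = c * B $$ (i,j)"
        unfolding G_def \<sigma> c_def by (rule poly_image_lift_node[OF j])
      moreover have "poly (G i) (t j - \<sigma>) = g * gam_vec k (\<delta> * (t j - \<sigma>) + \<tau>) $ i"
        using i unfolding G_eq[OF i] g by (simp add: gam_vec_def u_def poly_power algebra_simps)
      ultimately show "(c \<cdot>\<^sub>v (B *\<^sub>v unit_vec (k+1) j)) $ i = (g \<cdot>\<^sub>v gam_vec k (\<delta> * (t j - \<sigma>) + \<tau>)) $ i"
        using B(1) i by (simp del: index_mult_mat_vec)
    qed (use B(1) in simp)
    then have "proj (B *\<^sub>v unit_vec (k+1) j) = gam k (\<delta> * (t j - \<sigma>) + \<tau>)"
      unfolding gam_eq_proj using proj_smult[OF c0] proj_smult[OF g0] by metis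
    then show ?thesis
      using image_proj[OF B(1), of "unit_vec (k+1) j"] unfolding SB pt_e_def by simp
  qed
qed

section \<open>The orbit of \<open>S (pt_e k k)\<close> and the equation for \<delta>\<close>

text \<open>The affine map has fixed point 1, so each application multiplies \<open>s - 1\<close> by
  \<delta>. Avoiding \<open>indet k F\<close> before time \<open>m\<close> lets \<open>F\<close> be
  replaced by \<open>F_C\<close> at every step.\<close>

lemma iterate_curve:
  assumes ind: "induced_automorphism k F (curve_C k) F_C"
    and F_C: "\<And>s. F_C (gam k s) = gam k (\<delta> * (s - 1) + 1)"
    and reg: "\<forall>j<m. \<exists>p. iterate F j (gam k v) = Some p \<and> p \<notin> indet k F"
  shows "iterate F m (gam k v) = Some (gam k (\<delta> ^ m * (v - 1) + 1))"
  using reg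
proof (induction m)
  case 0
  then show ?case by (simp add: iterate_def)
next
  case (Suc m)
  let ?p = "gam k (\<delta> ^ m * (v - 1) + 1)"
  have it: "iterate F m (gam k v) = Some ?p" using Suc by simp
  then have "?p \<notin> indet k F" using Suc.prems by auto
  then have "F ?p = Some (F_C ?p)" by (rule induced_automorphism_gam[OF ind])
  then show ?case using it by (simp add: iterate_def F_C algebra_simps)
qed

theorem lemma4p1:
  fixes k n :: nat
    and S T :: "ppoint \<Rightarrow> ppoint"
    and F :: "ppoint \<Rightarrow> ppoint option"
    and F_C :: "ppoint \<Rightarrow> ppoint"
    and \<delta> :: complex
    and t :: "nat \<Rightarrow> complex"
  assumes "k \<ge> 2" and "n \<ge> 1"
    and "S \<in> Aut_PS k" and "T \<in> Aut_PS k"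
    and "F = basic_cremona k S T"
    and "properly_fixes_C k S T"
    and "\<forall>j<k. S (pt_e k j) = T (pt_e k (j + 1))"
    and "iterate F (n - 1) (S (pt_e k k)) = Some (T (pt_e k 0))"
    and "\<forall>j<n - 1. \<exists>p. iterate F j (S (pt_e k k)) = Some p \<and> p \<notin> indet k F"
    and "induced_automorphism k F (curve_C k) F_C"
    and "\<forall>s. F_C (gam k s) = gam k (\<delta> * (s - 1) + 1)"
    and "\<delta> \<noteq> 0" and "\<forall>m\<ge>1. \<delta> ^ m \<noteq> 1"
    and "\<forall>j\<le>k. gam k (t j) = T (pt_e k j)"
  shows "(\<delta> ^ (n + k) - 1) * (\<delta>\<^sup>2 - 1) - \<delta> * (\<delta> ^ (k + 1) - 1) * (\<delta> ^ (n - 1) - 1) = 0 \<and>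
    (\<forall>j\<le>k. t j = \<delta> ^ j * (of_nat (k + 1) / of_nat (k - 1))
                   * ((\<delta>\<^sup>2 - 1) / (\<delta> * (\<delta> ^ (k + 1) - 1)))
                 - 2 / of_nat (k - 1))"
proof -
  define \<sigma> where "\<sigma> = (\<Sum>j\<le>k. t j)"
  define K where "K = (of_nat (k - 1) :: complex)"
  have k: "k \<ge> 2" by fact
  have K0: "K \<noteq> 0" using k by (simp add: K_def)
  have K2: "of_nat (k + 1) = K + 2" using k unfolding K_def by (simp add: of_nat_diff)
  have d1: "\<delta> \<noteq> 1" "\<delta> ^ (k+1) \<noteq> 1" using assms(13)[rule_format, of 1] assms(13)[rule_format, of "k+1"] by auto
  have ind: "induced_automorphism k (basic_cremona k S T) (curve_C k) F_C" using assms by simp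
  have FC: "F_C (gam k s) = gam k (\<delta> * s + (1 - \<delta>))" for s
  proof -
    have "\<delta> * (s - 1) + 1 = \<delta> * s + (1 - \<delta>)" by (simp add: algebra_simps)
    then show ?thesis using assms(11) by metis
  qed
  note rel = cremona_curve_relations[OF k assms(3,4) ind FC assms(12) assms(14)[rule_format] \<sigma>_def]
  have \<sigma>: "K * \<sigma> * \<delta> = (K + 2) * (1 - \<delta>)" using rel(1) unfolding K2 K_def[symmetric] by simp
  define h where "h s = s + 2 / K" for s
  \<comment> \<open>\<open>- 2 / K\<close> is the fixed point of the recursion \<open>t\<^sub>j\<^sub>+\<^sub>1 = \<delta> (t\<^sub>j - \<sigma>) + 1 - \<delta>\<close>.\<close>
  have step: "h (\<delta> * (s - \<sigma>) + (1 - \<delta>)) = \<delta> * h s" for s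
    using \<sigma> K0 by (simp add: h_def field_simps)
  \<comment> \<open>Hypothesis (a) equates the points of the curve with these two
    parameters.\<close>
  have rec: "t (Suc j) = \<delta> * (t j - \<sigma>) + (1 - \<delta>)" if "j < k" for j
    using rel(2)[of j] assms(7,14) that by (intro gam_inject[OF k]) auto
  have ht: "h (t j) = \<delta> ^ j * h (t 0)" if "j \<le> k" for j
    using that
  proof (induction j)
    case (Suc j)
    then show ?case using step[of "t j"] rec[of j] by simp
  qed simp
  \<comment> \<open>Summing \<open>h (t j)\<close> directly and as a geometric series gives a linear
    equation for \<open>h (t 0)\<close>.\<close>
  have "\<sigma> + of_nat (k + 1) * (2 / K) = (\<Sum>j\<le>k. h (t j))"
    by (simp add: h_def sum.distrib \<sigma>_def)
  also have "\<dots> = (\<Sum>j\<le>k. \<delta> ^ j) * h (t 0)"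
    unfolding sum_distrib_right by (rule sum.cong[OF refl ht]) simp
  also have "(\<Sum>j\<le>k. \<delta> ^ j) = (\<delta> ^ (k+1) - 1) / (\<delta> - 1)"
    using d1 geometric_sum[of \<delta> "k+1"] by (simp add: lessThan_Suc_atMost)
  finally have "(\<sigma> + (K + 2) * (2 / K)) * (\<delta> - 1) = (\<delta> ^ (k+1) - 1) * h (t 0)"
    unfolding K2 using d1 by (simp add: field_simps)
  moreover have "K * \<sigma> * \<delta> + 2 * (K + 2) * \<delta> = K * \<delta> * (\<sigma> + (K + 2) * (2 / K))"
    using K0 by (simp add: field_simps)
  ultimately have "(K * \<sigma> * \<delta> + 2 * (K + 2) * \<delta>) * (\<delta> - 1) = (\<delta> ^ (k+1) - 1) * h (t 0) * K * \<delta>"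
    by (simp only: mult.assoc mult.commute mult.left_commute)
  \<comment> \<open>By the relation for \<sigma>, the bracket
    \<open>K * \<sigma> * \<delta> + 2 * (K + 2) * \<delta>\<close> equals
    \<open>(K + 2) * (1 + \<delta>)\<close>.\<close>
  then have h0: "h (t 0) * (K * \<delta> * (\<delta> ^ (k+1) - 1)) = (K + 2) * (\<delta>\<^sup>2 - 1)"
    unfolding \<sigma> by (simp add: algebra_simps power2_eq_square)
  moreover have "K * \<delta> * (\<delta> ^ (k+1) - 1) \<noteq> 0"
    using K0 assms(12) d1 by (simp del: power_Suc)
  ultimately have h0': "h (t 0) = (K + 2) / K * ((\<delta>\<^sup>2 - 1) / (\<delta> * (\<delta> ^ (k+1) - 1)))"
    by (simp only: times_divide_times_eq mult.assoc eq_divide_eq if_True simp_thms)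
  have main: "t j = \<delta> ^ j * (of_nat (k + 1) / of_nat (k - 1))
      * ((\<delta>\<^sup>2 - 1) / (\<delta> * (\<delta> ^ (k + 1) - 1))) - 2 / of_nat (k - 1)" if "j \<le> k" for j
    using ht[OF that] unfolding h0' unfolding K2 K_def[symmetric] h_def by (simp only: mult.assoc eq_diff_eq)
  define v where "v = \<delta> * (t k - \<sigma>) + (1 - \<delta>)"
  have Sk: "S (pt_e k k) = gam k v" using rel(2)[of k] by (simp add: v_def)
  have "gam k (t 0) = gam k (\<delta> ^ (n - 1) * (v - 1) + 1)"
    using iterate_curve[OF assms(10) assms(11)[rule_format], of "n - 1" v] assms(8,9,14)
    unfolding Sk by simp
  from gam_inject[OF k this] have v: "t 0 - 1 = \<delta> ^ (n - 1) * (v - 1)" by simp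
  \<comment> \<open>The recursion extends one step past \<open>t k\<close>, to the parameter
    \<open>v\<close> of \<open>S (pt_e k k)\<close>.\<close>
  have hv: "h v = \<delta> ^ (k+1) * h (t 0)"
    using step[of "t k"] ht[of k] by (simp add: v_def)
  \<comment> \<open>The recursion is centered at \<open>- 2 / K\<close> but \<open>F_C\<close> at 1;
    this identity passes from one center to the other, as \<open>K * h 1 = K + 2\<close>.\<close>
  have h1: "K * h s - (K + 2) = K * (s - 1)" for s
    using K0 by (simp add: h_def algebra_simps)
  have "K * h (t 0) - (K + 2) = \<delta> ^ (n - 1) * (K * h v - (K + 2))"
    unfolding h1 v by simp
  moreover have "\<delta> ^ (n + k) = \<delta> ^ (n - 1) * \<delta> ^ (k+1)"
    unfolding power_add[symmetric] using assms(2) by simp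
  ultimately have *: "K * h (t 0) * (\<delta> ^ (n + k) - 1) = (K + 2) * (\<delta> ^ (n - 1) - 1)"
    unfolding hv by (simp add: algebra_simps)
  \<comment> \<open>\<open>h (t 0)\<close> is eliminated between its closed form \<open>h0\<close>
    and the orbit condition \<open>*\<close>.\<close>
  have "(K + 2) * (\<delta>\<^sup>2 - 1) * (\<delta> ^ (n + k) - 1) =
      \<delta> * (\<delta> ^ (k+1) - 1) * (K * h (t 0) * (\<delta> ^ (n + k) - 1))"
    unfolding h0[symmetric] by (simp only: mult.assoc mult.commute mult.left_commute)
  then have "(K + 2) * ((\<delta>\<^sup>2 - 1) * (\<delta> ^ (n + k) - 1)) =
      (K + 2) * (\<delta> * (\<delta> ^ (k+1) - 1) * (\<delta> ^ (n - 1) - 1))"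
    unfolding * by (simp only: mult.assoc mult.left_commute)
  moreover have "K + 2 \<noteq> 0" unfolding K2[symmetric] by (metis Suc_eq_plus1 of_nat_neq_0)
  ultimately have "(\<delta> ^ (n + k) - 1) * (\<delta>\<^sup>2 - 1) = \<delta> * (\<delta> ^ (k+1) - 1) * (\<delta> ^ (n - 1) - 1)"
    by (metis mult_left_cancel mult.commute)
  then show ?thesis using main by (metis eq_iff_diff_eq_0)
qed

end
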